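(* Let $(\mathbb{R}^{3},g_{Nil})$ denote Nil space, where the metric with respect to the standard coordinates $(x,y,z)$ in $\mathbb{R}^{3}$ is $g_{Nil}={\rm d}x^{2}+{\rm d}y^{2}+({\rm d}z-x\,{\rm d}y)^{2}$. A linear map $\varphi:\mathbb{R}^{m}\to(\mathbb{R}^{3},g_{Nil})$ from Euclidean space (with its standard metric) into Nil space is $\infty$-harmonic if and only if $\varphi$ is a composition of a linear map $\mathbb{R}^{m}\to\mathbb{R}^{2}$ followed by the inclusion map $i_{1}:\mathbb{R}^{2}\to\mathbb{R}^{3}$, $i_{1}(y,z)=(0,y,z)$, or $\varphi$ is a composition of a linear map $\mathbb{R}^{m}\to\mathbb{R}^{2}$ followed by the inclusion map $i_{2}:\mathbb{R}^{2}\to\mathbb{R}^{3}$, $i_{2}(x,z)=(x,0,z)$.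
   Context: A smooth map $\varphi:(M,g)\to(N,h)$ between Riemannian manifolds is called $\infty$-harmonic if $\tfrac12\,{\rm d}\varphi({\rm grad}\,|{\rm d}\varphi|^2)=0$ on $M$, where $|{\rm d}\varphi|^2={\rm Trace}_g\,\varphi^*h$ is the energy density of $\varphi$ and the gradient is taken with respect to $g$. *)

theory Defs
  imports "HOL-Analysis.Analysis"
begin

text \<open>
  All manifolds here are covered by one global linear chart, so a manifold is a Euclidean space
  together with a metric tensor. Every tangent space is identified with the ambient vector space,
  and \<open>g p u v\<close> is the inner product of the tangent vectors \<open>u\<close> and \<open>v\<close> at the point \<open>p\<close>.
\<close>

type_synonym 'a metric_tensor = "'a \<Rightarrow> 'a \<Rightarrow> 'a \<Rightarrow> real"

text \<open>
  On a finite-dimensional domain, a differentiable map is \<open>C\<^sup>k\<^sup>+\<^sup>1\<close> iff all its directional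
  derivatives are \<open>C\<^sup>k\<close>.
\<close>

primrec k_smooth :: "nat \<Rightarrow> ('a::euclidean_space \<Rightarrow> 'b::real_normed_vector) \<Rightarrow> bool" where
  "k_smooth 0 f \<longleftrightarrow> continuous_on UNIV f"
| "k_smooth (Suc k) f \<longleftrightarrow>
     (\<forall>x. f differentiable (at x)) \<and> (\<forall>v. k_smooth k (\<lambda>x. frechet_derivative f (at x) v))"

definition smooth_map :: "('a::euclidean_space \<Rightarrow> 'b::real_normed_vector) \<Rightarrow> bool" where
  "smooth_map f \<longleftrightarrow> (\<forall>k. k_smooth k f)"

definition riemannian_metric :: "'a::euclidean_space metric_tensor \<Rightarrow> bool" where
  "riemannian_metric g \<longleftrightarrow>
     (\<forall>p. bilinear (g p) \<and> (\<forall>u v. g p u v = g p v u) \<and> (\<forall>u. u \<noteq> 0 \<longrightarrow> g p u u > 0)) \<and>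
     (\<forall>u v. smooth_map (\<lambda>p. g p u v))"

definition pullback_metric ::
  "('a::euclidean_space \<Rightarrow> 'b::euclidean_space) \<Rightarrow> 'b metric_tensor \<Rightarrow> 'a metric_tensor" where
  "pullback_metric \<phi> h p u v =
     h (\<phi> p) (frechet_derivative \<phi> (at p) u) (frechet_derivative \<phi> (at p) v)"

text \<open>
  The trace of a bilinear form \<open>b\<close> with respect to a metric \<open>g\<close> is the trace of the endomorphism
  obtained from \<open>b\<close> by raising an index; in coordinates, \<open>\<Sum>i j. g\<^sup>i\<^sup>j b\<^sub>i\<^sub>j\<close>.
\<close>

definition raise_index :: "'a::euclidean_space metric_tensor \<Rightarrow> 'a metric_tensor \<Rightarrow> 'a \<Rightarrow> 'a \<Rightarrow> 'a" where
  "raise_index g b p = (THE L. linear L \<and> (\<forall>u v. g p (L u) v = b p u v))"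

definition metric_trace :: "'a::euclidean_space metric_tensor \<Rightarrow> 'a metric_tensor \<Rightarrow> 'a \<Rightarrow> real" where
  "metric_trace g b p = (\<Sum>e\<in>Basis. raise_index g b p e \<bullet> e)"

definition metric_gradient :: "'a::euclidean_space metric_tensor \<Rightarrow> ('a \<Rightarrow> real) \<Rightarrow> 'a \<Rightarrow> 'a" where
  "metric_gradient g f p = (THE w. \<forall>v. g p w v = frechet_derivative f (at p) v)"

definition energy_density ::
  "'a::euclidean_space metric_tensor \<Rightarrow> 'b::euclidean_space metric_tensor \<Rightarrow> ('a \<Rightarrow> 'b) \<Rightarrow> 'a \<Rightarrow> real" where
  "energy_density g h \<phi> = metric_trace g (pullback_metric \<phi> h)"

definition infinity_harmonic ::
  "'a::euclidean_space metric_tensor \<Rightarrow> 'b::euclidean_space metric_tensor \<Rightarrow> ('a \<Rightarrow> 'b) \<Rightarrow> bool" where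
  "infinity_harmonic g h \<phi> \<longleftrightarrow>
     smooth_map \<phi> \<and>
     (\<forall>p. (1/2) *\<^sub>R frechet_derivative \<phi> (at p)
              (metric_gradient g (energy_density g h \<phi>) p) = 0)"

definition flat_metric :: "'a::euclidean_space metric_tensor" where
  "flat_metric p u v = u \<bullet> v"

definition nil_metric :: "(real^3) metric_tensor" where
  "nil_metric p u v =
     u$1 * v$1 + u$2 * v$2 + (u$3 - p$1 * u$2) * (v$3 - p$1 * v$2)"

definition incl_yz :: "real^2 \<Rightarrow> real^3" where
  "incl_yz w = vector [0, w$1, w$2]"

definition incl_xz :: "real^2 \<Rightarrow> real^3" where
  "incl_xz w = vector [w$1, 0, w$2]"

lemma k_smooth_const: "k_smooth k (\<lambda>x. c)"
  by (induction k arbitrary: c) auto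

lemma fd_lin: "linear f \<Longrightarrow> frechet_derivative f (at x) = f" for f :: "'a::euclidean_space \<Rightarrow> 'b::real_normed_vector"
  by (metis frechet_derivative_at linear_imp_has_derivative)

lemma k_smooth_linear: "linear f \<Longrightarrow> k_smooth k f"
  by (cases k) (auto simp: fd_lin k_smooth_const linear_continuous_on linear_conv_bounded_linear
     bounded_linear_imp_differentiable)

lemma fd_plus: assumes "f differentiable at x" "g differentiable at x"
  shows "frechet_derivative (\<lambda>x. f x + g x) (at x) = (\<lambda>v. frechet_derivative f (at x) v + frechet_derivative g (at x) v)"
  by (rule frechet_derivative_at[symmetric], rule has_derivative_add) (use assms in \<open>auto simp: frechet_derivative_works\<close>)

lemma fd_mult: fixes f g :: "_ \<Rightarrow> real"
  assumes "f differentiable at x" "g differentiable at x"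
  shows "frechet_derivative (\<lambda>x. f x * g x) (at x) = (\<lambda>v. f x * frechet_derivative g (at x) v + frechet_derivative f (at x) v * g x)"
  by (rule frechet_derivative_at[symmetric], rule has_derivative_mult) (use assms in \<open>auto simp: frechet_derivative_works\<close>)

lemma k_smooth_add: "k_smooth k f \<Longrightarrow> k_smooth k g \<Longrightarrow> k_smooth k (\<lambda>x. f x + g x)"
  by (induction k arbitrary: f g)
     (auto intro: continuous_intros simp: fd_plus)

lemma k_smooth_cmult: "k_smooth k f \<Longrightarrow> k_smooth k (\<lambda>x. c * f x)" for f :: "_ \<Rightarrow> real"
proof (induction k arbitrary: f)
  case (Suc k)
  have "frechet_derivative (\<lambda>x. c * f x) (at x) v = c * frechet_derivative f (at x) v" for x v
    using fd_mult[of "\<lambda>x. c" x f] Suc.prems by simp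
  then show ?case using Suc by auto
qed (auto intro: continuous_intros)

lemma k_smooth_linear_mult:
  fixes a b :: "'a::euclidean_space \<Rightarrow> real"
  assumes "linear a" "linear b" shows "k_smooth k (\<lambda>x. a x * b x)"
proof (cases k)
  case 0 have "continuous_on UNIV a" "continuous_on UNIV b" using assms by (auto intro!: linear_continuous_on simp: linear_conv_bounded_linear)
 then show ?thesis using 0 by (auto intro: continuous_on_mult)
next
  case (Suc j)
  have d: "a differentiable at x" "b differentiable at x" for x
    using assms by (auto simp: linear_conv_bounded_linear bounded_linear_imp_differentiable)
  have lc: "linear (\<lambda>x. a x * b v + a v * b x)" for v using assms by (simp add: linear_iff algebra_simps)
  have "frechet_derivative (\<lambda>x. a x * b x) (at x) v = a x * b v + a v * b x" for x v
    using fd_mult[OF d] assms by (simp add: fd_lin)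
  then show ?thesis using Suc d by (auto intro!: k_smooth_linear linear_compose_add lc assms)
qed

lemma riemannian_flat_metric: "riemannian_metric (flat_metric :: 'a::euclidean_space metric_tensor)"
  by (auto simp: riemannian_metric_def flat_metric_def smooth_map_def k_smooth_const inner_commute
      bilinear_def linear_iff inner_add_left inner_add_right)

lemma nil_bil: "bilinear (nil_metric p)"
  by (auto simp: nil_metric_def bilinear_def linear_iff algebra_simps)

lemma nil_pos: "u \<noteq> 0 \<Longrightarrow> nil_metric p u u > 0"
proof (rule ccontr)
  assume "u \<noteq> 0" and n: "\<not> nil_metric p u u > 0"
  then have "u$1*u$1 + u$2*u$2 + (u$3 - p$1*u$2)*(u$3 - p$1*u$2) \<le> 0" by (simp add: nil_metric_def)
  then have "u$1 * u$1 = 0 \<and> u$2 * u$2 = 0 \<and> (u$3 - p$1*u$2)*(u$3 - p$1*u$2) = 0"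
    by (smt (verit) zero_le_square)
  then have "u = 0" by (auto simp: vec_eq_iff forall_3)
  then show False using \<open>u \<noteq> 0\<close> by simp
qed

lemma riemannian_nil_metric: "riemannian_metric nil_metric"
proof -
  have "k_smooth k (\<lambda>p. nil_metric p u v)" for k u v
  proof -
    define a where "a = u$1 * v$1 + u$2 * v$2 + u$3 * v$3"
    define b where "b = - (u$3 * v$2 + v$3 * u$2)"
    define c where "c = u$2 * v$2"
    have e: "(\<lambda>p. nil_metric p u v) = (\<lambda>p. a + (b * p$1 + c * (p$1 * p$1)))"
      by (auto simp: nil_metric_def a_def b_def c_def algebra_simps)
    have l: "linear (\<lambda>p::real^3. p$1)" by (simp add: linear_iff)
    show ?thesis unfolding e
      by (intro k_smooth_add k_smooth_const k_smooth_cmult k_smooth_linear_mult l k_smooth_linear)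
  qed
  then show ?thesis
    unfolding riemannian_metric_def smooth_map_def using nil_bil nil_pos by (auto simp: nil_metric_def algebra_simps)
qed

end

(*
  Let a, b, c be the rows of the matrix of \<phi>, and let X = a \<bullet> p. The energy density at p is
  |a|^2 + |b|^2 + |c - X b|^2, whose Euclidean gradient is 2 (X |b|^2 - b \<bullet> c) a, so \<phi> is
  infinity-harmonic iff (X |b|^2 - b \<bullet> c) \<phi>(a) vanishes for all p. The first component of \<phi>(a)
  is |a|^2. Hence if a is nonzero, the scalar factor vanishes identically; evaluating at p = 0 and
  p = a then gives b = 0.
*)
theory Submission
  imports Defs
begin

text \<open>The basis is orthonormal, so a vector whose inner product with \<open>v\<close> is
  \<open>b p u v\<close> must have the coordinates \<open>b p u e\<close>. Inner products determine
  a vector, which gives the uniqueness that \<open>THE\<close> requires.\<close>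

lemma raise_index_flat_metric:
  assumes "bilinear (b p)"
  shows "raise_index flat_metric b p u = (\<Sum>e\<in>Basis. b p u e *\<^sub>R e)"
proof -
  define L where "L u = (\<Sum>e\<in>Basis. b p u e *\<^sub>R e)" for u
  have lin: "linear L"
    unfolding L_def using assms
    by (intro linearI)
      (simp_all add: bilinear_ladd bilinear_lmul scaleR_add_left sum.distrib scaleR_sum_right)
  have eq: "L u \<bullet> v = b p u v" for u v
  proof -
    have v: "linear (b p u)" using assms by (simp add: bilinear_def)
    have "b p u v = b p u (\<Sum>e\<in>Basis. (v \<bullet> e) *\<^sub>R e)"
      by (simp add: euclidean_representation)
    also have "\<dots> = (\<Sum>e\<in>Basis. (v \<bullet> e) * b p u e)"
      by (simp add: linear_sum[OF v] linear_cmul[OF v])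
    also have "\<dots> = L u \<bullet> v"
      by (simp add: L_def inner_sum_left inner_commute[of v] mult.commute)
    finally show ?thesis by simp
  qed
  have "raise_index flat_metric b p = L"
    unfolding raise_index_def flat_metric_def
  proof (rule the_equality)
    show "linear L \<and> (\<forall>u v. L u \<bullet> v = b p u v)" using lin eq by simp
    fix K assume "linear K \<and> (\<forall>u v. K u \<bullet> v = b p u v)"
    then show "K = L" using eq by (metis ext vector_eq_rdot)
  qed
  then show ?thesis by (simp add: L_def)
qed

lemma metric_trace_flat_metric:
  assumes "bilinear (b p)"
  shows "metric_trace flat_metric b p = (\<Sum>e\<in>Basis. b p e e)"
  by (simp add: metric_trace_def raise_index_flat_metric[of b, OF assms])

text \<open>A derivative of the form \<open>w \<bullet> v\<close> determines \<open>w\<close> by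
  nondegeneracy of the inner product, so the \<open>THE\<close> is resolved by exhibiting
  \<open>w\<close>.\<close>

lemma metric_gradient_flat_metric:
  assumes "(f has_derivative (\<lambda>v. w \<bullet> v)) (at p)"
  shows "metric_gradient flat_metric f p = w"
  unfolding metric_gradient_def flat_metric_def frechet_derivative_at[OF assms, symmetric]
  by (rule the_equality) (auto simp: vector_eq_rdot)

text \<open>A linear map is its own derivative at every point, so the density depends on
  \<open>p\<close> only through the base point \<open>\<phi> p\<close> of \<open>h\<close>.\<close>

lemma energy_density_flat_metric_linear:
  assumes "linear \<phi>" "bilinear (h (\<phi> p))"
  shows "energy_density flat_metric h \<phi> p = (\<Sum>e\<in>Basis. h (\<phi> p) (\<phi> e) (\<phi> e))"
proof -
  have pb: "pullback_metric \<phi> h p = (\<lambda>u v. h (\<phi> p) (\<phi> u) (\<phi> v))"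
    by (intro ext) (simp add: pullback_metric_def fd_lin[OF assms(1)])
  have "bilinear (pullback_metric \<phi> h p)"
    using assms unfolding pb bilinear_def by (auto simp: linear_iff)
  then show ?thesis
    by (simp add: energy_density_def metric_trace_flat_metric pb)
qed

text \<open>Taking the row as an adjoint image makes it a vector of the domain, so that each
  coordinate of \<open>\<phi>\<close> becomes the inner product with a fixed vector.\<close>

definition matrix_row :: "('a::euclidean_space \<Rightarrow> real^'n) \<Rightarrow> 'n \<Rightarrow> 'a" where
  "matrix_row \<phi> i = adjoint \<phi> (axis i 1)"

lemma inner_matrix_row:
  assumes "linear \<phi>"
  shows "x \<bullet> matrix_row \<phi> i = \<phi> x $ i"
  using adjoint_works[OF assms] by (simp add: matrix_row_def inner_axis)

lemma matrix_row_eq_0_iff: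
  assumes "linear \<phi>"
  shows "matrix_row \<phi> i = 0 \<longleftrightarrow> (\<forall>x. \<phi> x $ i = 0)"
  by (metis assms inner_matrix_row inner_eq_zero_iff inner_zero_right)

text \<open>On a basis vector \<open>e\<close> the Nil metric is a sum of squares of the inner
  products of \<open>e\<close> with \<open>a\<close>, \<open>b\<close> and
  \<open>c - (p \<bullet> a) *\<^sub>R b\<close>, where \<open>p \<bullet> a\<close> is the first
  coordinate of \<open>\<phi> p\<close>. Parseval's identity turns the sum over \<open>e\<close>
  into squared norms.\<close>

lemma energy_density_nil_metric:
  fixes \<phi> :: "'a::euclidean_space \<Rightarrow> real^3"
  assumes "linear \<phi>"
  defines "a \<equiv> matrix_row \<phi> 1" and "b \<equiv> matrix_row \<phi> 2" and "c \<equiv> matrix_row \<phi> 3"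
  shows "energy_density flat_metric nil_metric \<phi> p =
    a \<bullet> a + b \<bullet> b + (c - (p \<bullet> a) *\<^sub>R b) \<bullet> (c - (p \<bullet> a) *\<^sub>R b)"
proof -
  have "nil_metric (\<phi> p) (\<phi> e) (\<phi> e) =
      (a \<bullet> e) * (a \<bullet> e) + (b \<bullet> e) * (b \<bullet> e)
      + ((c - (p \<bullet> a) *\<^sub>R b) \<bullet> e) * ((c - (p \<bullet> a) *\<^sub>R b) \<bullet> e)" for e
    unfolding nil_metric_def inner_matrix_row[OF assms(1), symmetric] a_def b_def c_def
    by (simp add: inner_diff_right inner_commute)
  then show ?thesis
    by (simp only: energy_density_flat_metric_linear[of _ nil_metric, OF assms(1) nil_bil] sum.distrib
        euclidean_inner[symmetric])
qed

text \<open>Only the last square varies with \<open>p\<close>, and only through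
  \<open>p \<bullet> a\<close>; the chain rule therefore gives a multiple of
  \<open>a\<close>.\<close>

lemma gradient_energy_density_nil_metric:
  fixes \<phi> :: "'a::euclidean_space \<Rightarrow> real^3"
  assumes "linear \<phi>"
  defines "a \<equiv> matrix_row \<phi> 1" and "b \<equiv> matrix_row \<phi> 2" and "c \<equiv> matrix_row \<phi> 3"
  shows "metric_gradient flat_metric (energy_density flat_metric nil_metric \<phi>) p =
    (2 * ((p \<bullet> a) * (b \<bullet> b) - b \<bullet> c)) *\<^sub>R a"
proof (rule metric_gradient_flat_metric)
  have e: "energy_density flat_metric nil_metric \<phi> =
      (\<lambda>p. a \<bullet> a + b \<bullet> b + (c - (p \<bullet> a) *\<^sub>R b) \<bullet> (c - (p \<bullet> a) *\<^sub>R b))"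
    unfolding a_def b_def c_def using energy_density_nil_metric[OF assms(1)] by (intro ext)
  show "(energy_density flat_metric nil_metric \<phi> has_derivative
      (\<lambda>v. (2 * ((p \<bullet> a) * (b \<bullet> b) - b \<bullet> c)) *\<^sub>R a \<bullet> v)) (at p)"
    unfolding e
    by (auto intro!: derivative_eq_intros ext simp: inner_diff_left inner_diff_right inner_commute algebra_simps)
qed

lemma infinity_harmonic_nil_metric_iff:
  fixes \<phi> :: "'a::euclidean_space \<Rightarrow> real^3"
  assumes "linear \<phi>"
  shows "infinity_harmonic flat_metric nil_metric \<phi> \<longleftrightarrow>
    (\<forall>x. \<phi> x $ 1 = 0) \<or> (\<forall>x. \<phi> x $ 2 = 0)"
proof -
  define a b c where "a = matrix_row \<phi> 1" and "b = matrix_row \<phi> 2" and "c = matrix_row \<phi> 3"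
  \<comment> \<open>Smoothness is automatic for a linear map, the factor 2 of the gradient cancels
    the 1/2, and linearity moves the scalar out of \<open>\<phi>\<close>.\<close>
  have "infinity_harmonic flat_metric nil_metric \<phi> \<longleftrightarrow>
      (\<forall>p. ((p \<bullet> a) * (b \<bullet> b) - b \<bullet> c) *\<^sub>R \<phi> a = 0)"
    using assms
    by (auto simp: infinity_harmonic_def smooth_map_def k_smooth_linear fd_lin linear_cmul
        gradient_energy_density_nil_metric a_def b_def c_def)
  also have "\<dots> \<longleftrightarrow> a = 0 \<or> b = 0"
  proof
    assume h: "\<forall>p. ((p \<bullet> a) * (b \<bullet> b) - b \<bullet> c) *\<^sub>R \<phi> a = 0"
    show "a = 0 \<or> b = 0"
    proof (cases "a = 0")
      case False
      have "\<phi> a $ 1 \<noteq> 0"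
        using False by (metis a_def inner_matrix_row[OF assms] inner_eq_zero_iff)
      then have "\<phi> a \<noteq> 0" by auto
      then have z: "(p \<bullet> a) * (b \<bullet> b) = b \<bullet> c" for p using h by simp
      have "(a \<bullet> a) * (b \<bullet> b) = 0" using z[of a] z[of 0] by simp
      then show ?thesis using False by simp
    qed simp
  \<comment> \<open>Converse: \<open>a = 0\<close> makes \<open>\<phi> a\<close> vanish, and
    \<open>b = 0\<close> makes the scalar vanish.\<close>
  qed (auto simp: linear_0[OF assms])
  finally show ?thesis
    by (simp add: a_def b_def matrix_row_eq_0_iff[OF assms])
qed

text \<open>The image of \<open>incl_yz\<close> is the plane where the first coordinate is 0; the
  linear factor is obtained from \<open>\<phi>\<close> by dropping that coordinate.\<close>

lemma incl_yz_factorization_iff: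
  fixes \<phi> :: "'a::real_vector \<Rightarrow> real^3"
  assumes "linear \<phi>"
  shows "(\<exists>L. linear L \<and> \<phi> = incl_yz \<circ> L) \<longleftrightarrow> (\<forall>x. \<phi> x $ 1 = 0)"
proof
  assume "\<forall>x. \<phi> x $ 1 = 0"
  then have "\<phi> = incl_yz \<circ> (\<lambda>x. vector [\<phi> x $ 2, \<phi> x $ 3])"
    by (auto simp: fun_eq_iff incl_yz_def vec_eq_iff forall_3)
  moreover have "linear (\<lambda>x. vector [\<phi> x $ 2, \<phi> x $ 3] :: real^2)"
    using assms by (auto simp: linear_iff vec_eq_iff forall_2)
  ultimately show "\<exists>L. linear L \<and> \<phi> = incl_yz \<circ> L" by blast
qed (auto simp: incl_yz_def)

lemma incl_xz_factorization_iff: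
  fixes \<phi> :: "'a::real_vector \<Rightarrow> real^3"
  assumes "linear \<phi>"
  shows "(\<exists>L. linear L \<and> \<phi> = incl_xz \<circ> L) \<longleftrightarrow> (\<forall>x. \<phi> x $ 2 = 0)"
proof
  assume "\<forall>x. \<phi> x $ 2 = 0"
  then have "\<phi> = incl_xz \<circ> (\<lambda>x. vector [\<phi> x $ 1, \<phi> x $ 3])"
    by (auto simp: fun_eq_iff incl_xz_def vec_eq_iff forall_3)
  moreover have "linear (\<lambda>x. vector [\<phi> x $ 1, \<phi> x $ 3] :: real^2)"
    using assms by (auto simp: linear_iff vec_eq_iff forall_2)
  ultimately show "\<exists>L. linear L \<and> \<phi> = incl_xz \<circ> L" by blast
qed (auto simp: incl_xz_def)

theorem theorem5p2:
  fixes \<phi> :: "real^'m \<Rightarrow> real^3"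
  assumes "linear \<phi>"
  shows "infinity_harmonic flat_metric nil_metric \<phi> \<longleftrightarrow>
     (\<exists>L :: real^'m \<Rightarrow> real^2. linear L \<and> \<phi> = incl_yz \<circ> L) \<or>
     (\<exists>L :: real^'m \<Rightarrow> real^2. linear L \<and> \<phi> = incl_xz \<circ> L)"
  unfolding incl_yz_factorization_iff[OF assms] incl_xz_factorization_iff[OF assms]
  by (rule infinity_harmonic_nil_metric_iff[OF assms])

end
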